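(* Let $A,B\subset\mathbb{R}^n$ be nonempty, convex and compact sets with $A\cap B=\varnothing$. Let $(\gamma_k)_{k\in\mathbb{N}}$, $(\theta_k)_{k\in\mathbb{N}}$, $(\lambda_k)_{k\in\mathbb{N}}$ be summable sequences of nonnegative real numbers, i.e. $\sum_k\gamma_k<\infty$, $\sum_k\theta_k<\infty$, $\sum_k\lambda_k<\infty$, with $0\le\lambda_k<1/2$ for all $k$. For each $k$ let $\varphi_k=\varphi_{\gamma_k,\theta_k,\lambda_k}$ be a relative error tolerance function with forcing parameters $\gamma_k,\theta_k,\lambda_k$. Let $(x^k)_{k\in\mathbb{N}}$ and $(y^k)_{k\in\mathbb{N}}$ be infinite sequences generated by the ACondG-2 method. Then $(x^k)$ and $(y^k)$ converge, respectively, to points $x^*\in A$ and $y^*\in B$ satisfying $\|x^*-y^*\|=\mathrm{dist}(A,B)$.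
   Context: Notation: $\mathbb{N}=\{0,1,2,\ldots\}$; $\langle\cdot,\cdot\rangle$ is the usual inner product and $\|\cdot\|$ the Euclidean norm on $\mathbb{R}^n$; $\mathrm{dist}(A,B)=\inf\{\|v-w\|: v\in A,\ w\in B\}$. Relative error tolerance function: for $\gamma,\theta,\lambda\ge 0$, $\varphi_{\gamma,\theta,\lambda}:\mathbb{R}^n\times\mathbb{R}^n\times\mathbb{R}^n\to\mathbb{R}_+$ is any function satisfying $\varphi_{\gamma,\theta,\lambda}(u,v,w)\le\gamma\|v-u\|^2+\theta\|w-v\|^2+\lambda\|w-u\|^2$ for all $u,v,w\in\mathbb{R}^n$. CondG$_C$ procedure (for a compact convex nonempty set $C$, $v\in\mathbb{R}^n$, $u\in C$): start from some $w_0\in C$, $\ell=0$. Step 1: compute $z_\ell\in\arg\min_{z\in C}\langle w_\ell-v,z-w_\ell\rangle$ and $s_\ell^*=\langle w_\ell-v,z_\ell-w_\ell\rangle$. Step 2: if $-s_\ell^*\le\varphi_{\gamma,\theta,\lambda}(u,v,w_\ell)$, stop and output $w^+:=w_\ell$. Step 3: otherwise set $\alpha_\ell=\min\{1,-s_\ell^*/\|z_\ell-w_\ell\|^2\}$, $w_{\ell+1}=w_\ell+\alpha_\ell(z_\ell-w_\ell)$, $\ell\leftarrow\ell+1$, and return to Step 1. The output is written $w^+=\mathrm{CondG}_C(\varphi_{\gamma,\theta,\lambda},u,v)$. (Thus $w^+\in C$ and $\langle v-w^+,z-w^+\rangle\le\varphi_{\gamma,\theta,\lambda}(u,v,w^+)$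 for all $z\in C$.) ACondG-2 method: Step 0: choose $x^0\in A$, $y^0\in B$; if $x^0\in B$ or $y^0\in A$, stop; set $k=0$. Step 1: $y^{k+1}:=\mathrm{CondG}_B(\varphi_k,y^k,x^k)$; if $y^{k+1}\in A$, stop. Step 2: $x^{k+1}:=\mathrm{CondG}_A(\varphi_k,x^k,y^{k+1})$; if $x^{k+1}\in B$, stop. Step 3: $k\leftarrow k+1$ and go to Step 1. It is assumed that each call of CondG terminates with an output. *)

theory Defs
  imports "HOL-Analysis.Analysis"
begin

definition rel_error_tolerance ::
    "real \<Rightarrow> real \<Rightarrow> real \<Rightarrow> (real^'n \<Rightarrow> real^'n \<Rightarrow> real^'n \<Rightarrow> real) \<Rightarrow> bool" where
  "rel_error_tolerance \<gamma> \<theta> l \<phi> \<longleftrightarrow>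
     (\<forall>u v w. 0 \<le> \<phi> u v w \<and>
        \<phi> u v w \<le> \<gamma> * (norm (v - u))\<^sup>2 + \<theta> * (norm (w - v))\<^sup>2 + l * (norm (w - u))\<^sup>2)"

text \<open>
  The conditional gradient procedure is nondeterministic (choice of the starting point and of the
  minimisers), so it is modelled by relations. \<^term>\<open>condG_from C \<phi> u v w w'\<close> means that some run
  whose current iterate is \<^term>\<open>w\<close> stops after finitely many iterations with output \<^term>\<open>w'\<close>.
\<close>

definition condG_argmin :: "(real^'n) set \<Rightarrow> real^'n \<Rightarrow> real^'n \<Rightarrow> real^'n \<Rightarrow> bool" where
  "condG_argmin C v w z \<longleftrightarrow> is_arg_min (\<lambda>z. (w - v) \<bullet> (z - w)) (\<lambda>z. z \<in> C) z"

inductive condG_from ::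
    "(real^'n) set \<Rightarrow> (real^'n \<Rightarrow> real^'n \<Rightarrow> real^'n \<Rightarrow> real) \<Rightarrow> real^'n \<Rightarrow> real^'n
      \<Rightarrow> real^'n \<Rightarrow> real^'n \<Rightarrow> bool"
  for C \<phi> u v where
  stop: "condG_from C \<phi> u v w w"
    if "condG_argmin C v w z" and "s = (w - v) \<bullet> (z - w)" and "- s \<le> \<phi> u v w"
| step: "condG_from C \<phi> u v w w'"
    if "condG_argmin C v w z" and "s = (w - v) \<bullet> (z - w)" and "\<not> - s \<le> \<phi> u v w"
      and "\<alpha> = min 1 (- s / (norm (z - w))\<^sup>2)"
      and "condG_from C \<phi> u v (w + \<alpha> *\<^sub>R (z - w)) w'"

definition condG_output ::
    "(real^'n) set \<Rightarrow> (real^'n \<Rightarrow> real^'n \<Rightarrow> real^'n \<Rightarrow> real) \<Rightarrow> real^'n \<Rightarrow> real^'n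
      \<Rightarrow> real^'n \<Rightarrow> bool" where
  "condG_output C \<phi> u v w' \<longleftrightarrow> (\<exists>w0\<in>C. condG_from C \<phi> u v w0 w')"

text \<open>
  The infinite sequences generated by the alternating method, i.e. runs in which no stopping test
  ever succeeds.
\<close>

definition acondG2_sequences ::
    "(real^'n) set \<Rightarrow> (real^'n) set \<Rightarrow> (nat \<Rightarrow> real^'n \<Rightarrow> real^'n \<Rightarrow> real^'n \<Rightarrow> real)
      \<Rightarrow> (nat \<Rightarrow> real^'n) \<Rightarrow> (nat \<Rightarrow> real^'n) \<Rightarrow> bool" where
  "acondG2_sequences A B \<phi> x y \<longleftrightarrow>
     x 0 \<in> A \<and> y 0 \<in> B \<and> x 0 \<notin> B \<and> y 0 \<notin> A \<and>
     (\<forall>k. condG_output B (\<phi> k) (y k) (x k) (y (Suc k)) \<and> y (Suc k) \<notin> A \<and>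
          condG_output A (\<phi> k) (x k) (y (Suc k)) (x (Suc k)) \<and> x (Suc k) \<notin> B)"

end

theory Submission
  imports Defs
begin

text \<open>
  On a bounded set the tolerances are bounded by a summable sequence. An inexact projection is only
  accurate up to the square root of its tolerance, so the distances to the exact projections need
  not be summable. Instead, for a pair \<open>(a, b)\<close> realising \<open>dist(A, B)\<close>, add the inexact
  variational inequality of \<open>y\<^sup>k\<^sup>+\<^sup>1\<close>, tested at \<open>b\<close>, to the exact one of \<open>b = P\<^sub>B(a)\<close>, tested at
  \<open>y\<^sup>k\<^sup>+\<^sup>1\<close>. This gives
  \<open>\<parallel>y\<^sup>k\<^sup>+\<^sup>1 - b\<parallel>\<^sup>2 + \<parallel>(x\<^sup>k - y\<^sup>k\<^sup>+\<^sup>1) - (a - b)\<parallel>\<^sup>2 \<le> \<parallel>x\<^sup>k - a\<parallel>\<^sup>2 + 2\<epsilon>\<^sub>k\<close>, and symmetrically for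
  the other half step. Hence \<open>\<parallel>x\<^sup>k - a\<parallel>\<^sup>2\<close> decreases up to summable errors, and so converges for
  every such pair, while \<open>x\<^sup>k - y\<^sup>k\<^sup>+\<^sup>1\<close> tends to \<open>a - b\<close>. A cluster point of \<open>(x\<^sup>k)\<close> therefore belongs
  to a realising pair, and using that pair as \<open>(a, b)\<close> makes the whole sequence converge to it.
\<close>

text \<open>Induction along the run. At the stop, minimality of \<open>z\<close> carries the bound
  from \<open>z\<close> to every point of \<open>C\<close>; a step moves along a segment inside the
  convex set \<open>C\<close>.\<close>

lemma condG_from_correct:
  assumes "condG_from C \<phi> u v w w'" and "w \<in> C" and "convex C"
    and nonneg: "\<And>w. 0 \<le> \<phi> u v w"
  shows "w' \<in> C \<and> (\<forall>z\<in>C. (v - w') \<bullet> (z - w') \<le> \<phi> u v w')"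
  using assms(1,2)
proof induction
  case (stop w z s)
  have "(v - w) \<bullet> (z' - w) \<le> \<phi> u v w" if "z' \<in> C" for z'
  proof -
    have "(w - v) \<bullet> (z - w) \<le> (w - v) \<bullet> (z' - w)"
      using stop(1) that unfolding condG_argmin_def is_arg_min_linorder by blast
    moreover have "(v - w) \<bullet> (z' - w) = - ((w - v) \<bullet> (z' - w))"
      by (simp flip: inner_minus_left)
    ultimately show ?thesis using stop(2,3) by linarith
  qed
  then show ?case using stop(4) by blast
next
  case (step w z s \<alpha> w')
  have "z \<in> C"
    using step(1) by (simp add: condG_argmin_def is_arg_min_def)
  \<comment> \<open>A failed stopping test means \<open>- s\<close> exceeds a nonnegative tolerance,
    so the step length lies in [0, 1].\<close>
  have "0 \<le> - s" using step(3) nonneg[of w] by linarith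
  then have "0 \<le> \<alpha>" "\<alpha> \<le> 1"
    using step(4) divide_nonneg_nonneg[of "- s" "(norm (z - w))\<^sup>2"] by simp_all
  then have "(1 - \<alpha>) *\<^sub>R w + \<alpha> *\<^sub>R z \<in> C"
    using \<open>convex C\<close> \<open>z \<in> C\<close> step(7) by (simp add: convex_alt)
  moreover have "(1 - \<alpha>) *\<^sub>R w + \<alpha> *\<^sub>R z = w + \<alpha> *\<^sub>R (z - w)"
    by (simp add: algebra_simps)
  ultimately show ?case using step(6) by simp
qed

lemma condG_output_correct:
  assumes "condG_output C \<phi> u v w'" and "convex C" and "rel_error_tolerance \<gamma> \<theta> l \<phi>"
  shows "w' \<in> C" and "\<And>z. z \<in> C \<Longrightarrow> (v - w') \<bullet> (z - w') \<le> \<phi> u v w'"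
proof -
  obtain w0 where "w0 \<in> C" "condG_from C \<phi> u v w0 w'"
    using assms(1) unfolding condG_output_def by blast
  moreover have "0 \<le> \<phi> u v w" for w
    using assms(3) unfolding rel_error_tolerance_def by blast
  ultimately have "w' \<in> C \<and> (\<forall>z\<in>C. (v - w') \<bullet> (z - w') \<le> \<phi> u v w')"
    using condG_from_correct assms(2) by blast
  then show "w' \<in> C" and "\<And>z. z \<in> C \<Longrightarrow> (v - w') \<bullet> (z - w') \<le> \<phi> u v w'"
    by auto
qed

lemma rel_error_tolerance_bounded:
  assumes "rel_error_tolerance \<gamma> \<theta> l \<phi>" and "0 \<le> \<gamma>" "0 \<le> \<theta>" "0 \<le> l"
    and "bounded S" and "u \<in> S" "v \<in> S" "w \<in> S"
  shows "\<phi> u v w \<le> (\<gamma> + \<theta> + l) * (diameter S)\<^sup>2"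
proof -
  have "(norm (p - q))\<^sup>2 \<le> (diameter S)\<^sup>2" if "p \<in> S" "q \<in> S" for p q
    using diameter_bounded_bound[OF \<open>bounded S\<close> that] by (simp add: dist_norm power_mono)
  then have "\<gamma> * (norm (v - u))\<^sup>2 + \<theta> * (norm (w - v))\<^sup>2 + l * (norm (w - u))\<^sup>2
      \<le> \<gamma> * (diameter S)\<^sup>2 + \<theta> * (diameter S)\<^sup>2 + l * (diameter S)\<^sup>2"
    using assms by (intro add_mono mult_left_mono) auto
  then show ?thesis
    using assms(1) unfolding rel_error_tolerance_def by (smt (verit) distrib_right)
qed

lemma tendsto_norm_power2_cancel:
  fixes f :: "'b \<Rightarrow> 'a::real_normed_vector"
  assumes "((\<lambda>k. (norm (f k - a))\<^sup>2) \<longlongrightarrow> 0) F"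
  shows "(f \<longlongrightarrow> a) F"
  unfolding tendsto_dist_iff[of f] dist_norm
  using tendsto_real_sqrt[OF assms] unfolding real_sqrt_abs real_sqrt_zero abs_norm_cancel .

text \<open>With p = y - b and q = x - a, expand |p|^2 + |q - p|^2 = |q|^2 - 2 (q - p).p; the last
  term splits into the two variational expressions.\<close>

lemma inexact_projection_step:
  fixes a b x y :: "'a::real_inner"
  assumes "(x - y) \<bullet> (b - y) \<le> e" and "(a - b) \<bullet> (y - b) \<le> 0"
  shows "(norm (y - b))\<^sup>2 + (norm ((x - y) - (a - b)))\<^sup>2 \<le> (norm (x - a))\<^sup>2 + 2 * e"
proof -
  have "(norm (y - b))\<^sup>2 + (norm ((x - y) - (a - b)))\<^sup>2
      = (norm (x - a))\<^sup>2 + 2 * ((x - y) \<bullet> (b - y)) + 2 * ((a - b) \<bullet> (y - b))"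
    unfolding power2_norm_eq_inner by (simp add: inner_diff_left inner_diff_right inner_commute)
  with assms show ?thesis by linarith
qed

text \<open>A pair realising the distance has \<open>b\<close> as a nearest point of
  \<open>B\<close> to \<open>a\<close>.\<close>

lemma setdist_attained_dot:
  fixes a b :: "'a::euclidean_space"
  assumes "convex B" "closed B" "a \<in> A" "b \<in> B" "norm (a - b) = setdist A B" "y \<in> B"
  shows "(a - b) \<bullet> (y - b) \<le> 0"
proof (rule any_closest_point_dot[OF assms(1,2,4,6)])
  show "\<forall>z\<in>B. dist a b \<le> dist a z"
    using assms(3,5) setdist_le_dist by (metis dist_norm)
qed

text \<open>Subtracting the convergent partial sums of \<open>e\<close> leaves a decreasing sequence
  that is bounded below.\<close>

lemma convergent_almost_decreasing:
  fixes u e :: "nat \<Rightarrow> real"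
  assumes "\<And>k. 0 \<le> u k" and "\<And>k. u (Suc k) \<le> u k + e k" and "summable e"
  shows "convergent u"
proof -
  define s where "s k = (\<Sum>i<k. e i)" for k
  have s: "convergent s"
    using assms(3) unfolding s_def summable_iff_convergent .
  then obtain K where K: "\<And>k. \<bar>s k\<bar> \<le> K"
    using convergent_imp_Bseq[of s] unfolding Bseq_def real_norm_def by blast
  have dec: "decseq (\<lambda>k. u k - s k)"
    using assms(2) by (intro decseq_SucI) (simp add: s_def algebra_simps)
  have "- K \<le> u k - s k" for k
    using assms(1)[of k] K[of k] by linarith
  with dec have "convergent (\<lambda>k. u k - s k)"
    using decseq_convergent[of "\<lambda>k. u k - s k" "- K"] unfolding convergent_def by blast
  from convergent_add[OF this s] show ?thesis by simp
qed

text \<open>Since \<open>u\<close> converges, \<open>d k\<close> is squeezed between 0 and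
  \<open>u k - u (Suc k) + e k\<close>.\<close>

lemma almost_decreasing_decrement_tendsto_0:
  fixes u d e :: "nat \<Rightarrow> real"
  assumes "\<And>k. 0 \<le> u k" and "\<And>k. 0 \<le> d k"
    and "\<And>k. u (Suc k) + d k \<le> u k + e k" and "summable e"
  shows "d \<longlonglongrightarrow> 0"
proof -
  have "u (Suc k) \<le> u k + e k" for k using assms(2,3)[of k] by linarith
  then obtain L where L: "u \<longlonglongrightarrow> L"
    using convergent_almost_decreasing[of u e, OF assms(1) _ assms(4)]
    unfolding convergent_def by blast
  have "(\<lambda>k. u k - u (Suc k) + e k) \<longlonglongrightarrow> L - L + 0"
    by (intro tendsto_add tendsto_diff L LIMSEQ_Suc[OF L] summable_LIMSEQ_zero[OF assms(4)])
  then have lim: "(\<lambda>k. u k - u (Suc k) + e k) \<longlonglongrightarrow> 0" by simp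
  have "d k \<le> u k - u (Suc k) + e k" for k using assms(3)[of k] by linarith
  then show ?thesis
    by (intro tendsto_sandwich[OF _ _ tendsto_const lim] always_eventually allI assms(2))
qed

proposition inexact_alternating_projections_converge:
  fixes x y :: "nat \<Rightarrow> 'a::euclidean_space"
  assumes A: "A \<noteq> {}" "convex A" "compact A" and B: "B \<noteq> {}" "convex B" "compact B"
    and x: "\<And>k. x k \<in> A" and y: "\<And>k. y k \<in> B"
    and proj_B: "\<And>k z. z \<in> B \<Longrightarrow> (x k - y (Suc k)) \<bullet> (z - y (Suc k)) \<le> e k"
    and proj_A: "\<And>k z. z \<in> A \<Longrightarrow> (y (Suc k) - x (Suc k)) \<bullet> (z - x (Suc k)) \<le> e k"
    and e: "summable e"
  shows "\<exists>xs\<in>A. \<exists>ys\<in>B. x \<longlonglongrightarrow> xs \<and> y \<longlonglongrightarrow> ys \<and> norm (xs - ys) = setdist A B"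
proof -
  \<comment> \<open>Both half steps are chained, each costing \<open>2 * e k\<close>; only the gap
    of the first one is kept.\<close>
  have decr: "(norm (x (Suc k) - a))\<^sup>2 + (norm ((x k - y (Suc k)) - (a - b)))\<^sup>2
      \<le> (norm (x k - a))\<^sup>2 + 4 * e k"
    if "a \<in> A" "b \<in> B" "norm (a - b) = setdist A B" for a b k
  proof -
    have "(a - b) \<bullet> (y (Suc k) - b) \<le> 0"
      using setdist_attained_dot that B y compact_imp_closed by blast
    then have "(norm (y (Suc k) - b))\<^sup>2 + (norm ((x k - y (Suc k)) - (a - b)))\<^sup>2
        \<le> (norm (x k - a))\<^sup>2 + 2 * e k"
      by (rule inexact_projection_step[OF proj_B[OF \<open>b \<in> B\<close>]])
    moreover have "(b - a) \<bullet> (x (Suc k) - a) \<le> 0"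
      using setdist_attained_dot[of A b B a] that A x compact_imp_closed[OF A(3)]
      by (simp add: norm_minus_commute setdist_sym)
    then have "(norm (x (Suc k) - a))\<^sup>2
        + (norm ((y (Suc k) - x (Suc k)) - (b - a)))\<^sup>2 \<le> (norm (y (Suc k) - b))\<^sup>2 + 2 * e k"
      by (rule inexact_projection_step[OF proj_A[OF \<open>a \<in> A\<close>]])
    ultimately show ?thesis
      using zero_le_power2[of "norm ((y (Suc k) - x (Suc k)) - (b - a))"] by linarith
  qed
  have e4: "summable (\<lambda>k. 4 * e k)" using e by (rule summable_mult)
  have gap: "(\<lambda>k. x k - y (Suc k)) \<longlonglongrightarrow> a - b"
    if "a \<in> A" "b \<in> B" "norm (a - b) = setdist A B" for a b
  proof -
    have "(\<lambda>k. (norm ((x k - y (Suc k)) - (a - b)))\<^sup>2) \<longlonglongrightarrow> 0"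
      by (rule almost_decreasing_decrement_tendsto_0[OF _ _ decr[OF that] e4]) auto
    then show ?thesis by (rule tendsto_norm_power2_cancel)
  qed
  obtain a b where ab: "a \<in> A" "b \<in> B" "norm (a - b) = setdist A B"
    using setdist_compact_closed[OF A(3) compact_imp_closed[OF B(3)] A(1) B(1)]
    by (auto simp: dist_norm)
  obtain xs r where xs: "xs \<in> A" and r: "strict_mono r" "(x \<circ> r) \<longlonglongrightarrow> xs"
    using A(3) x unfolding compact_def by metis
  \<comment> \<open>Along \<open>r\<close> the gap still tends to \<open>a - b\<close>, which forces
    this limit of \<open>y (Suc (r j))\<close>.\<close>
  define ys where "ys = xs - (a - b)"
  have "(\<lambda>j. (x \<circ> r) j - ((\<lambda>k. x k - y (Suc k)) \<circ> r) j) \<longlonglongrightarrow> ys"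
    unfolding ys_def by (intro tendsto_diff r(2) LIMSEQ_subseq_LIMSEQ[OF gap[OF ab] r(1)])
  then have ys: "ys \<in> B"
    using closed_sequentially[OF compact_imp_closed[OF B(3)], of "\<lambda>j. y (Suc (r j))"] y by simp
  have dist: "norm (xs - ys) = setdist A B" using ab(3) by (simp add: ys_def)
  have "(norm (x (Suc k) - xs))\<^sup>2 \<le> (norm (x k - xs))\<^sup>2 + 4 * e k" for k
    using decr[OF xs ys dist, of k] zero_le_power2[of "norm ((x k - y (Suc k)) - (xs - ys))"]
    by linarith
  then have "convergent (\<lambda>k. (norm (x k - xs))\<^sup>2)"
    by (intro convergent_almost_decreasing[OF _ _ e4]) auto
  then obtain L where L: "(\<lambda>k. (norm (x k - xs))\<^sup>2) \<longlonglongrightarrow> L"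
    unfolding convergent_def by blast
  \<comment> \<open>The full sequence of squared distances converges, so its limit can be read off
    along \<open>r\<close>, where it is 0.\<close>
  have "(\<lambda>j. (norm ((x \<circ> r) j - xs))\<^sup>2) \<longlonglongrightarrow> (norm (xs - xs))\<^sup>2"
    by (intro tendsto_intros r(2))
  moreover have "(\<lambda>j. (norm ((x \<circ> r) j - xs))\<^sup>2) \<longlonglongrightarrow> L"
    using LIMSEQ_subseq_LIMSEQ[OF L r(1)] by (simp add: o_def)
  ultimately have "(norm (xs - xs))\<^sup>2 = L" by (rule LIMSEQ_unique)
  with L have "(\<lambda>k. (norm (x k - xs))\<^sup>2) \<longlonglongrightarrow> 0" by simp
  then have x_lim: "x \<longlonglongrightarrow> xs" by (rule tendsto_norm_power2_cancel)
  have "(\<lambda>k. x k - (x k - y (Suc k))) \<longlonglongrightarrow> xs - (xs - ys)"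
    by (intro tendsto_diff x_lim gap xs ys dist)
  then have "y \<longlonglongrightarrow> ys" by (simp add: filterlim_sequentially_Suc)
  with x_lim xs ys dist show ?thesis by blast
qed

theorem theorem11:
  fixes A B :: "(real^'n) set"
    and \<gamma> \<theta> l :: "nat \<Rightarrow> real"
    and \<phi> :: "nat \<Rightarrow> real^'n \<Rightarrow> real^'n \<Rightarrow> real^'n \<Rightarrow> real"
    and x y :: "nat \<Rightarrow> real^'n"
  assumes "A \<noteq> {}" and "convex A" and "compact A"
    and "B \<noteq> {}" and "convex B" and "compact B"
    and "A \<inter> B = {}"
    and "\<And>k. 0 \<le> \<gamma> k" and "\<And>k. 0 \<le> \<theta> k" and "\<And>k. 0 \<le> l k" and "\<And>k. l k < 1/2"
    and "summable \<gamma>" and "summable \<theta>" and "summable l"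
    and "\<And>k. rel_error_tolerance (\<gamma> k) (\<theta> k) (l k) (\<phi> k)"
    and "acondG2_sequences A B \<phi> x y"
  shows "\<exists>xs\<in>A. \<exists>ys\<in>B. x \<longlonglongrightarrow> xs \<and> y \<longlonglongrightarrow> ys \<and> norm (xs - ys) = setdist A B"
proof -
  have alg: "x 0 \<in> A" "y 0 \<in> B" "\<And>k. condG_output B (\<phi> k) (y k) (x k) (y (Suc k))"
    "\<And>k. condG_output A (\<phi> k) (x k) (y (Suc k)) (x (Suc k))"
    using assms(16) by (auto simp: acondG2_sequences_def)
  note projB = condG_output_correct[OF alg(3) assms(5,15)]
  note projA = condG_output_correct[OF alg(4) assms(2,15)]
  have x: "x k \<in> A" for k using alg(1) projA(1) by (cases k) auto
  have y: "y k \<in> B" for k using alg(2) projB(1) by (cases k) auto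
  \<comment> \<open>Each call mixes points of both sets, hence the diameter of the union.\<close>
  define e where "e k = (\<gamma> k + \<theta> k + l k) * (diameter (A \<union> B))\<^sup>2" for k
  have tol: "\<phi> k u v w \<le> e k" if "u \<in> A \<union> B" "v \<in> A \<union> B" "w \<in> A \<union> B" for k u v w
    unfolding e_def using assms(3,6) compact_imp_bounded
    by (intro rel_error_tolerance_bounded[OF assms(15,8,9,10) _ that]) blast
  have "summable e"
    unfolding e_def by (intro summable_mult2 summable_add assms(12-14))
  moreover have "(x k - y (Suc k)) \<bullet> (z - y (Suc k)) \<le> e k" if "z \<in> B" for k z
    by (rule order_trans[OF projB(2)[OF that] tol]) (use x y in auto)
  moreover have "(y (Suc k) - x (Suc k)) \<bullet> (z - x (Suc k)) \<le> e k" if "z \<in> A" for k z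
    by (rule order_trans[OF projA(2)[OF that] tol]) (use x y in auto)
  ultimately show ?thesis
    using assms(1-6) x y by (intro inexact_alternating_projections_converge)
qed

end
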